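(* Let $\epsilon_0>0$ be fixed, let $\eta_n\to 0$, and let $K=K_n\ge2$, $a=a_n$, $b=b_n$ satisfy $\epsilon_0<b<a$, $a/n<1-\epsilon_0$ and $\frac{nI}{K\log K}\to\infty$. Let $\hat\sigma\in\arg\max_{\sigma\in\Theta^0(n,K,a,b)}T(\sigma)$ be the penalized likelihood estimator with $\lambda$ given by the formula below (any fixed $w\in[0,1]$ when $K\ge 3$). Then $$\sup_{\sigma\in\Theta^0(n,K,a,b)}\mathbb{E}\, r(\hat\sigma,\sigma)\le\exp\Big(-(1+o(1))\frac{nI}{K}\Big).$$
   Context: SBM: for an assignment $\sigma:[n]\to[K]$ and probabilities $\{\theta_{i,j}\}$, one observes symmetric $A\in\{0,1\}^{n\times n}$ with $A_{i,i}=0$ and independent $A_{i,j}\sim\mathrm{Ber}(\theta_{i,j})$, $i<j$. $\Theta^0(n,K,a,b)$ (tolerance $\eta_n\to0$): assignments $\sigma$ with community sizes $n_k=|\{i:\sigma(i)=k\}|\in[(1-\eta_n)\frac nK,(1+\eta_n)\frac nK]$ for all $k$, with $\theta_{i,j}=a/n$ if $\sigma(i)=\sigma(j)$ and $b/n$ otherwise ($i\ne j$). $I=-2\log\big(\sqrt{\frac{a}{n}\frac{b}{n}}+\sqrt{(1-\frac{a}{n})(1-\frac{b}{n})}\big)$. $T(\sigma)=\sum_{i<j}A_{i,j}\mathbf 1\{\sigma(i)=\sigma(j)\}-\lambda\sum_{i<j}\mathbf 1\{\sigma(i)=\sigma(j)\}$, $t^\star=\frac12\log\frac{a(1-b/n)}{b(1-a/n)}$,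 $$\lambda=\begin{cases}-\frac{1}{2t^\star}\log\big(\frac an e^{-t^\star}+1-\frac an\big)+\frac{1}{2t^\star}\log\big(\frac bn e^{t^\star}+1-\frac bn\big), & K=2,\\ -\frac{w}{t^\star}\log\big(\frac an e^{-t^\star}+1-\frac an\big)+\frac{1-w}{t^\star}\log\big(\frac bn e^{t^\star}+1-\frac bn\big), & K\ge3,\end{cases}$$ $w\in[0,1]$ constant; ties broken arbitrarily. $r(\sigma,\hat\sigma)=\min_\delta d_H(\sigma,\delta\circ\hat\sigma)/n$ over permutations $\delta$ of $[K]$. "$\exp(-(1+o(1))G)$" means $\exp(-(1+\delta_n)G)$ for some $\delta_n\to0$. *)

theory Defs
  imports "HOL-Probability.Probability" "HOL-Combinatorics.Permutations"
begin

text \<open>Vertices are 0..n-1, communities are 0..K-1.  Unordered pairs i<j.\<close>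
definition sbm_pairs :: "nat \<Rightarrow> (nat \<times> nat) set" where
  "sbm_pairs n = {(i, j). i < j \<and> j < n}"

definition Theta0 :: "nat \<Rightarrow> nat \<Rightarrow> real \<Rightarrow> (nat \<Rightarrow> nat) set" where
  "Theta0 n K eta = {\<sigma> \<in> {..<n} \<rightarrow>\<^sub>E {..<K}.
      \<forall>k<K. (1 - eta) * real n / real K \<le> real (card {i. i < n \<and> \<sigma> i = k}) \<and>
             real (card {i. i < n \<and> \<sigma> i = k}) \<le> (1 + eta) * real n / real K}"

definition sbm_theta :: "nat \<Rightarrow> real \<Rightarrow> real \<Rightarrow> (nat \<Rightarrow> nat) \<Rightarrow> nat \<times> nat \<Rightarrow> real" where
  "sbm_theta n a b \<sigma> p = (if \<sigma> (fst p) = \<sigma> (snd p) then a / real n else b / real n)"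

definition sbm_graph :: "nat \<Rightarrow> real \<Rightarrow> real \<Rightarrow> (nat \<Rightarrow> nat) \<Rightarrow> (nat \<times> nat \<Rightarrow> bool) pmf" where
  "sbm_graph n a b \<sigma> = Pi_pmf (sbm_pairs n) False (\<lambda>p. bernoulli_pmf (sbm_theta n a b \<sigma> p))"

definition sbm_I :: "nat \<Rightarrow> real \<Rightarrow> real \<Rightarrow> real" where
  "sbm_I n a b = -2 * ln (sqrt (a / n * (b / n)) + sqrt ((1 - a / n) * (1 - b / n)))"

definition sbm_tstar :: "nat \<Rightarrow> real \<Rightarrow> real \<Rightarrow> real" where
  "sbm_tstar n a b = ln ((a * (1 - b / n)) / (b * (1 - a / n))) / 2"

definition sbm_lambda :: "nat \<Rightarrow> nat \<Rightarrow> real \<Rightarrow> real \<Rightarrow> real \<Rightarrow> real" where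
  "sbm_lambda n K a b w =
    (let t = sbm_tstar n a b in
     if K = 2 then
       - (1 / (2 * t)) * ln (a / n * exp (- t) + 1 - a / n)
       + (1 / (2 * t)) * ln (b / n * exp t + 1 - b / n)
     else
       - (w / t) * ln (a / n * exp (- t) + 1 - a / n)
       + ((1 - w) / t) * ln (b / n * exp t + 1 - b / n))"

definition sbm_T :: "nat \<Rightarrow> real \<Rightarrow> (nat \<times> nat \<Rightarrow> bool) \<Rightarrow> (nat \<Rightarrow> nat) \<Rightarrow> real" where
  "sbm_T n lam A \<sigma> =
     (\<Sum>p\<in>sbm_pairs n. (if A p then 1 else 0) * (if \<sigma> (fst p) = \<sigma> (snd p) then 1 else 0))
     - lam * (\<Sum>p\<in>sbm_pairs n. if \<sigma> (fst p) = \<sigma> (snd p) then 1 else 0)"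

definition sbm_r :: "nat \<Rightarrow> nat \<Rightarrow> (nat \<Rightarrow> nat) \<Rightarrow> (nat \<Rightarrow> nat) \<Rightarrow> real" where
  "sbm_r n K \<sigma> \<sigma>' = Min {real (card {i. i < n \<and> \<sigma> i \<noteq> \<delta> (\<sigma>' i)}) / real n | \<delta>. \<delta> permutes {..<K}}"

end

theory Submission
  imports Defs
begin

text \<open>Let \<open>\<sigma>'\<close> be the estimate, relabelled to be as close as possible to the truth \<open>\<sigma>\<close>, and let
  \<open>m\<close> be their Hamming distance. Since the score of \<open>\<sigma>'\<close> is at least that of \<open>\<sigma>\<close>, the risk is
  pointwise at most \<open>m0 / n\<close> plus the sum of \<open>(m / n) exp (t\<^sup>\<star> (T \<sigma>' - T \<sigma>))\<close> over all
  assignments \<open>\<sigma>'\<close> that are optimally labelled and have \<open>m \<ge> m0\<close>. In expectation each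
  exponential is at most \<open>exp (- I min \<alpha> \<gamma>)\<close>, with \<open>\<alpha>\<close> and \<open>\<gamma>\<close> the numbers of pairs that \<open>\<sigma>'\<close>
  separates and merges. Both numbers are at least \<open>(1 - o(1)) n m / K\<close> when \<open>m\<close> is small compared
  with \<open>n / K\<close>, and at least \<open>n m / (20 K)\<close> always, while there are at most \<open>(e n K / m) ^ m\<close>
  assignments at distance \<open>m\<close>. Taking \<open>m0 = 2 e n K exp (- c)\<close> with \<open>c = (1 - o(1)) n I / K\<close>
  makes the sum geometric and the total \<open>O(K exp (- c))\<close>; the factor \<open>K\<close> is absorbed by
  \<open>n I / (K log K) \<rightarrow> \<infinity>\<close>.\<close>

subsection \<open>Pairs separated by a second assignment\<close>

definition disagreements :: "nat \<Rightarrow> (nat \<Rightarrow> nat) \<Rightarrow> (nat \<Rightarrow> nat) \<Rightarrow> nat set" where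
  "disagreements n s t = {i. i < n \<and> s i \<noteq> t i}"

text \<open>With \<open>s\<close> the truth and \<open>t\<close> the estimate these are the
  separated pairs; swapping the two arguments gives the merged pairs, so one lower bound serves both
  counts.\<close>

definition split_pairs :: "nat \<Rightarrow> (nat \<Rightarrow> nat) \<Rightarrow> (nat \<Rightarrow> nat) \<Rightarrow> (nat \<times> nat) set" where
  "split_pairs n s t = {p \<in> sbm_pairs n. s (fst p) = s (snd p) \<and> t (fst p) \<noteq> t (snd p)}"

lemma finite_sbm_pairs [simp]: "finite (sbm_pairs n)"
  by (rule finite_subset[of _ "{..<n} \<times> {..<n}"]) (auto simp: sbm_pairs_def)

lemma finite_split_pairs [simp]: "finite (split_pairs n s t)"
  by (simp add: split_pairs_def)

lemma finite_disagreements [simp]: "finite (disagreements n s t)"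
  by (simp add: disagreements_def)

lemma card_disagreements_le: "card (disagreements n s t) \<le> n"
  using card_mono[of "{..<n}" "disagreements n s t"] by (auto simp: disagreements_def)

text \<open>Every unordered pair occurs in both orders and the diagonal contributes nothing.
  Counting vertex by vertex produces ordered pairs, and this identity converts such counts.\<close>

lemma card_ordered_split_pairs:
  "card {(i, j). i < n \<and> j < n \<and> s i = s j \<and> t i \<noteq> t j} = 2 * card (split_pairs n s t)"
proof -
  let ?S = "split_pairs n s t"
  have "{(i, j). i < n \<and> j < n \<and> s i = s j \<and> t i \<noteq> t j} = ?S \<union> prod.swap ` ?S"
  proof (intro equalityI subsetI)
    fix p assume p: "p \<in> {(i, j). i < n \<and> j < n \<and> s i = s j \<and> t i \<noteq> t j}"
    obtain i j where ij: "p = (i, j)" by (cases p)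
    consider "i < j" | "j < i" | "i = j" by linarith
    then show "p \<in> ?S \<union> prod.swap ` ?S"
    proof cases
      case 2
      then have "(j, i) \<in> ?S" using p ij by (auto simp: split_pairs_def sbm_pairs_def)
      then have "prod.swap (j, i) \<in> prod.swap ` ?S" by (rule imageI)
      then show ?thesis by (simp add: ij)
    qed (use p ij in \<open>auto simp: split_pairs_def sbm_pairs_def\<close>)
  qed (auto simp: split_pairs_def sbm_pairs_def)
  moreover have "?S \<inter> prod.swap ` ?S = {}"
    by (auto simp: split_pairs_def sbm_pairs_def)
  moreover have "card (prod.swap ` ?S) = card ?S"
    by (rule card_image) (auto intro: inj_on_subset[OF inj_swap])
  ultimately show ?thesis
    by (simp add: card_Un_disjoint)
qed

text \<open>If \<open>i\<close> is a disagreement and \<open>j\<close> is an agreeing member of its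
  \<open>s\<close>-community, then \<open>t j = s j = s i\<close>, which differs from
  \<open>t i\<close>. Each of the \<open>m\<close> disagreements finds at least \<open>L - m\<close>
  such partners, and no pair is found twice because only one endpoint disagrees.\<close>

lemma card_split_pairs_ge_near:
  fixes L :: real and s t :: "nat \<Rightarrow> nat"
  assumes L: "\<And>i. i < n \<Longrightarrow> L \<le> real (card {j. j < n \<and> s j = s i})"
  defines "m \<equiv> card (disagreements n s t)"
  shows "real m * (L - real m) \<le> real (card (split_pairs n s t))"
proof -
  let ?D = "disagreements n s t"
  let ?V = "\<lambda>i. {j. j < n \<and> s j = s i} - ?D"
  let ?U = "SIGMA i:?D. ?V i"
  let ?O = "{(i, j). i < n \<and> j < n \<and> s i = s j \<and> t i \<noteq> t j}"
  have fin: "finite ?U" by (intro finite_SigmaI) auto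
  have finO: "finite ?O" by (rule finite_subset[of _ "{..<n} \<times> {..<n}"]) auto
  have "?U \<union> prod.swap ` ?U \<subseteq> ?O"
    by (auto simp: disagreements_def)
  then have "card (?U \<union> prod.swap ` ?U) \<le> card ?O"
    by (intro card_mono finO)
  moreover have "?U \<inter> prod.swap ` ?U = {}" by auto
  moreover have "card (prod.swap ` ?U) = card ?U"
    by (rule card_image) (auto intro: inj_on_subset[OF inj_swap])
  ultimately have "2 * card ?U \<le> 2 * card (split_pairs n s t)"
    using fin by (simp add: card_Un_disjoint card_ordered_split_pairs)
  then have "card ?U \<le> card (split_pairs n s t)" by simp
  moreover have "card ?U = (\<Sum>i\<in>?D. card (?V i))"
    by (rule card_SigmaI) auto
  moreover have "real m * (L - real m) \<le> (\<Sum>i\<in>?D. real (card (?V i)))"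
  proof -
    have "L - real m \<le> real (card (?V i))" if "i \<in> ?D" for i
    proof -
      have "card {j. j < n \<and> s j = s i} - m \<le> card (?V i)"
        unfolding m_def by (rule diff_card_le_card_Diff) simp
      moreover have "L \<le> real (card {j. j < n \<and> s j = s i})"
        using that by (intro L) (simp add: disagreements_def)
      ultimately show ?thesis by linarith
    qed
    then have "(\<Sum>i\<in>?D. L - real m) \<le> (\<Sum>i\<in>?D. real (card (?V i)))"
      by (rule sum_mono)
    then show ?thesis by (simp add: m_def)
  qed
  moreover have "(\<Sum>i\<in>?D. real (card (?V i))) = real (\<Sum>i\<in>?D. card (?V i))"
    by simp
  ultimately show ?thesis by linarith
qed

text \<open>The complements of \<open>S\<close> and of its image in \<open>A\<close> have equal
  size, so any bijection between them completes \<open>f\<close>.\<close>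

lemma inj_on_extend_permutes:
  assumes fin: "finite A" and S: "S \<subseteq> A" "f ` S \<subseteq> A" "inj_on f S"
  obtains p where "p permutes A" "\<And>x. x \<in> S \<Longrightarrow> p x = f x"
proof -
  have finS: "finite S" using fin S finite_subset by blast
  have "card (A - S) = card (A - f ` S)"
    using S finS by (simp add: card_Diff_subset card_image)
  then obtain g where g: "bij_betw g (A - S) (A - f ` S)"
    using fin by (metis finite_Diff finite_same_card_bij)
  let ?h = "\<lambda>x. if x \<in> S then f x else g x"
  have h: "bij_betw ?h A A"
    using bij_betw_disjoint_Un[OF inj_on_imp_bij_betw[OF S(3)] g] S
    by (simp add: Un_absorb1 Un_Diff_cancel)
  let ?p = "\<lambda>x. if x \<in> A then ?h x else x"
  have "bij_betw ?p A A"
    using h by (subst bij_betw_cong[of A ?p ?h]) auto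
  then have "?p permutes A" by (rule bij_imp_permutes) simp
  then show thesis using that S by force
qed

text \<open>Send each community of \<open>s\<close> to the one of \<open>t\<close> it overlaps most. On the communities losing
  fewer than \<open>(2 * L - U) / 2\<close> members this is injective, as two of them would overflow a
  community of \<open>t\<close>; a permutation extending it on those is therefore a good alignment.\<close>
lemma card_split_pairs_ge_aligned:
  fixes L U :: real
  assumes s: "\<And>i. i < n \<Longrightarrow> s i < K" and t: "\<And>i. i < n \<Longrightarrow> t i < K"
    and sL: "\<And>k. k < K \<Longrightarrow> L \<le> real (card {i. i < n \<and> s i = k})"
    and sU: "\<And>k. k < K \<Longrightarrow> real (card {i. i < n \<and> s i = k}) \<le> U"
    and tU: "\<And>k. k < K \<Longrightarrow> real (card {i. i < n \<and> t i = k}) \<le> U"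
    and L: "0 \<le> L" "U < 2 * L" and K: "0 < K"
    and m: "\<And>\<delta>. \<delta> permutes {..<K} \<Longrightarrow> m \<le> real (card (disagreements n t (\<delta> \<circ> s)))"
  shows "m * (2 * L - U) * L \<le> 4 * U * real (card (split_pairs n s t))"
proof -
  define M where "M k l = card {j. j < n \<and> s j = k \<and> t j \<noteq> l}" for k l
  have "\<exists>l<K. \<forall>l'<K. M k l \<le> M k l'" for k
    using ex_has_least_nat[of "\<lambda>l. l < K" 0 "M k"] K by (metis (no_types, lifting))
  then obtain l where lK: "\<And>k. l k < K" and lmin: "\<And>k l'. l' < K \<Longrightarrow> M k (l k) \<le> M k l'"
    by metis
  define B where "B k = real (M k (l k))" for k
  have B0: "0 \<le> B k" for k by (simp add: B_def)
  have LU: "L \<le> U" using sL[OF K] sU[OF K] by linarith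
  have U0: "0 < 2 * L - U" "0 < U" using L LU by auto
  \<comment> \<open>A vertex of community \<open>k\<close> with \<open>t\<close>-label
    \<open>l'\<close> is separated from exactly \<open>M k l'\<close> members of \<open>k\<close>,
    hence from at least \<open>B k\<close>. Summing over communities of size at least
    \<open>L\<close> counts ordered pairs, whence the factor 2.\<close>
  have over: "L * (\<Sum>k<K. B k) \<le> 2 * real (card (split_pairs n s t))"
  proof -
    have "L * (\<Sum>k<K. B k) = (\<Sum>k<K. L * B k)" by (simp add: sum_distrib_left)
    also have "\<dots> \<le> (\<Sum>k<K. real (card {i. i < n \<and> s i = k}) * B k)"
      by (intro sum_mono mult_right_mono sL B0) auto
    also have "\<dots> = (\<Sum>k<K. \<Sum>i\<in>{i \<in> {..<n}. s i = k}. B (s i))"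
      by (intro sum.cong) auto
    also have "\<dots> = (\<Sum>i<n. B (s i))"
      by (rule sum.group) (use s in auto)
    also have "\<dots> \<le> (\<Sum>i<n. real (card {j. j < n \<and> s i = s j \<and> t i \<noteq> t j}))"
    proof (intro sum_mono)
      fix i assume "i \<in> {..<n}"
      then have "M (s i) (l (s i)) \<le> M (s i) (t i)" using lmin t by simp
      also have "M (s i) (t i) = card {j. j < n \<and> s i = s j \<and> t i \<noteq> t j}"
        unfolding M_def by (rule arg_cong[where f = card]) auto
      finally show "B (s i) \<le> real (card {j. j < n \<and> s i = s j \<and> t i \<noteq> t j})"
        by (simp add: B_def)
    qed
    also have "\<dots> = real (card (SIGMA i:{..<n}. {j. j < n \<and> s i = s j \<and> t i \<noteq> t j}))"
      by (subst card_SigmaI) auto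
    also have "(SIGMA i:{..<n}. {j. j < n \<and> s i = s j \<and> t i \<noteq> t j})
        = {(i, j). i < n \<and> j < n \<and> s i = s j \<and> t i \<noteq> t j}" by auto
    finally show ?thesis by (simp add: card_ordered_split_pairs)
  qed
  define S where "S = {k. k < K \<and> 2 * B k < 2 * L - U}"
  have split: "{j. j < n \<and> s j = k} = {j. j < n \<and> s j = k \<and> t j = l'} \<union> {j. j < n \<and> s j = k \<and> t j \<noteq> l'}"
    for k l' by auto
  have size: "real (card {j. j < n \<and> s j = k}) = real (card {j. j < n \<and> s j = k \<and> t j = l k}) + B k" for k
    unfolding B_def M_def by (subst split[of k "l k"], subst card_Un_disjoint) auto
  have overlap: "card {j. j < n \<and> s j = k \<and> t j = l'} + card {j. j < n \<and> s j = k' \<and> t j = l'}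
      \<le> card {j. j < n \<and> t j = l'}" if "k \<noteq> k'" for k k' l'
  proof -
    have "{j. j < n \<and> s j = k \<and> t j = l'} \<inter> {j. j < n \<and> s j = k' \<and> t j = l'} = {}"
      using that by blast
    then show ?thesis
      by (subst card_Un_disjoint[symmetric]) (auto intro: card_mono)
  qed
  \<comment> \<open>Each community in \<open>S\<close> keeps more than
    \<open>L - (2 * L - U) / 2 = U / 2\<close> members at its target, so two with a common target
    would put more than \<open>U\<close> vertices there.\<close>
  have inj: "inj_on l S"
  proof (rule inj_onI, rule ccontr)
    fix k k' assume kk: "k \<in> S" "k' \<in> S" "l k = l k'" "k \<noteq> k'"
    have "card {j. j < n \<and> s j = k \<and> t j = l k} + card {j. j < n \<and> s j = k' \<and> t j = l k'}
        \<le> card {j. j < n \<and> t j = l k}"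
      unfolding kk(3) using kk(4) by (rule overlap)
    then have "real (card {j. j < n \<and> s j = k \<and> t j = l k})
        + real (card {j. j < n \<and> s j = k' \<and> t j = l k'}) \<le> U"
      using tU[OF lK[of k]] by linarith
    moreover have "L \<le> real (card {j. j < n \<and> s j = k})" "L \<le> real (card {j. j < n \<and> s j = k'})"
      using kk by (auto intro: sL simp: S_def)
    ultimately show False
      using kk size[of k] size[of k'] by (auto simp: S_def)
  qed
  obtain p where p: "p permutes {..<K}" "\<And>k. k \<in> S \<Longrightarrow> p k = l k"
    using inj_on_extend_permutes[of "{..<K}" S l] inj lK by (auto simp: S_def)
  have "disagreements n t (p \<circ> s) = (\<Union>k<K. {j. j < n \<and> s j = k \<and> t j \<noteq> p k})"
    using s by (auto simp: disagreements_def)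
  then have "card (disagreements n t (p \<circ> s)) \<le> (\<Sum>k<K. M k (p k))"
    unfolding M_def by (simp add: card_UN_le)
  then have "m \<le> (\<Sum>k<K. real (M k (p k)))"
    using m[OF p(1)] unfolding of_nat_sum[symmetric] by linarith
  then have "m * (2 * L - U) \<le> (\<Sum>k<K. real (M k (p k))) * (2 * L - U)"
    using U0 by (intro mult_right_mono) auto
  also have "\<dots> = (\<Sum>k<K. real (M k (p k)) * (2 * L - U))" by (simp add: sum_distrib_right)
  also have "\<dots> \<le> (\<Sum>k<K. 2 * U * B k)"
  proof (intro sum_mono)
    fix k assume k: "k \<in> {..<K}"
    \<comment> \<open>On \<open>S\<close> the loss under \<open>p\<close> is the minimum
      \<open>B k\<close>, and \<open>2 * L - U\<close> is below \<open>2 * U\<close>. Off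
      \<open>S\<close> the loss is at most the community size, hence \<open>U\<close>, while
      \<open>2 * B k\<close> is at least \<open>2 * L - U\<close>.\<close>
    show "real (M k (p k)) * (2 * L - U) \<le> 2 * U * B k"
    proof (cases "k \<in> S")
      case True
      have "B k * (2 * L - U) \<le> B k * (2 * U)"
        using LU U0 B0 by (intro mult_left_mono) auto
      then show ?thesis using True p by (simp add: B_def mult.commute)
    next
      case False
      have "M k (p k) \<le> card {i. i < n \<and> s i = k}"
        unfolding M_def by (rule card_mono) auto
      then have "real (M k (p k)) \<le> U" using sU[of k] k by simp
      then have "real (M k (p k)) * (2 * L - U) \<le> U * (2 * B k)"
        using False k U0 by (intro mult_mono) (auto simp: S_def)
      then show ?thesis by (simp add: algebra_simps)
    qed
  qed
  also have "\<dots> = 2 * U * (\<Sum>k<K. B k)" by (simp add: sum_distrib_left)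
  finally have "m * (2 * L - U) * L \<le> 2 * U * (\<Sum>k<K. B k) * L"
    using L by (intro mult_right_mono) auto
  also have "\<dots> = 2 * U * (L * (\<Sum>k<K. B k))" by simp
  also have "\<dots> \<le> 2 * U * (2 * real (card (split_pairs n s t)))"
    using over U0 by (intro mult_left_mono) auto
  finally show ?thesis by simp
qed

text \<open>An assignment is recovered from its disagreement set and its values there: elsewhere on
  the vertices it equals \<open>t\<close>, and beyond them it is \<open>undefined\<close>.\<close>

lemma card_assignments_disagreements_le:
  "card {s \<in> {..<n} \<rightarrow>\<^sub>E {..<K}. card (disagreements n s t) = m} \<le> (n choose m) * K ^ m"
proof -
  let ?A = "{s \<in> {..<n} \<rightarrow>\<^sub>E {..<K}. card (disagreements n s t) = m}"
  let ?D = "{D. D \<subseteq> {..<n} \<and> card D = m}"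
  let ?f = "\<lambda>s. (disagreements n s t, restrict s (disagreements n s t))"
  let ?B = "SIGMA D:?D. D \<rightarrow>\<^sub>E {..<K}"
  have fin: "finite ?D" by simp
  have finD: "finite D" if "D \<in> ?D" for D using that finite_subset by auto
  have finP: "finite (D \<rightarrow>\<^sub>E {..<K})" if "D \<in> ?D" for D
    by (rule finite_PiE) (use finD[OF that] in auto)
  have "inj_on ?f ?A"
  proof (rule inj_onI)
    fix s s' assume A: "s \<in> ?A" "s' \<in> ?A" and e: "?f s = ?f s'"
    show "s = s'"
    proof
      fix i
      consider "i \<ge> n" | "i < n" "i \<in> disagreements n s t" | "i < n" "i \<notin> disagreements n s t"
        by linarith
      then show "s i = s' i"
      proof cases
        case 1
        then show ?thesis using A by (auto simp: PiE_def extensional_def)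
      next
        case 2
        then show ?thesis using e by (metis prod.inject restrict_apply')
      next
        case 3
        moreover have "i \<notin> disagreements n s' t" using 3 e by simp
        ultimately show ?thesis by (simp add: disagreements_def)
      qed
    qed
  qed
  moreover have "?f ` ?A \<subseteq> ?B"
  proof (intro image_subsetI)
    fix s assume s: "s \<in> ?A"
    have sub: "disagreements n s t \<subseteq> {..<n}" by (auto simp: disagreements_def)
    moreover have "restrict s (disagreements n s t) \<in> disagreements n s t \<rightarrow>\<^sub>E {..<K}"
      using s sub by (auto intro!: restrict_PiE_iff[THEN iffD2])
    ultimately show "?f s \<in> ?B" using s by simp
  qed
  moreover have "finite ?B"
    by (intro finite_SigmaI fin finP)
  ultimately have "card ?A \<le> card ?B" by (rule card_inj_on_le)
  also have "card ?B = (\<Sum>D\<in>?D. card (D \<rightarrow>\<^sub>E {..<K}))"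
    by (intro card_SigmaI fin ballI finP)
  also have "\<dots> = (\<Sum>D\<in>?D. K ^ m)"
      proof (rule sum.cong[OF refl])
    fix D assume D: "D \<in> ?D"
    then show "card (D \<rightarrow>\<^sub>E {..<K}) = K ^ m"
      using card_PiE[OF finD[OF D], of "\<lambda>_. {..<K}"] by simp
  qed
  also have "\<dots> = (n choose m) * K ^ m" by (simp add: n_subsets)
  finally show ?thesis .
qed

text \<open>The quotient \<open>m ^ m / fact m\<close> is a single term of the series for
  \<open>exp m\<close>, and \<open>(n choose m) * fact m\<close> is at most \<open>n ^ m\<close>;
  multiply the two bounds.\<close>

lemma binomial_le_exp_power:
  assumes "m > 0"
  shows "real (n choose m) \<le> (exp 1 * real n / real m) ^ m"
proof -
  have "real m ^ m / fact m \<le> exp (real m)"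
  proof -
    have s: "(\<lambda>k. real m ^ k / fact k) sums exp (real m)"
      using exp_converges[of "real m"] by (simp add: field_simps)
    then have "(\<Sum>k\<in>{m}. real m ^ k / fact k) \<le> suminf (\<lambda>k. real m ^ k / fact k)"
      by (intro sum_le_suminf) (auto simp: sums_iff)
    then have "(\<Sum>k\<in>{m}. real m ^ k / fact k) \<le> exp (real m)"
      using s by (simp add: sums_iff)
    then show ?thesis by simp
  qed
  moreover have "real (n choose m) * fact m \<le> real n ^ m"
    using binomial_fact_pow[of n m] by (metis of_nat_fact of_nat_le_iff of_nat_mult of_nat_power)
  ultimately have "real (n choose m) * fact m * (real m ^ m / fact m) \<le> real n ^ m * exp (real m)"
    by (intro mult_mono) auto
  then have "real (n choose m) * real m ^ m \<le> (exp 1 * real n) ^ m"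
    by (simp add: power_mult_distrib mult.commute flip: exp_of_nat_mult)
  then show ?thesis using assms by (simp add: power_divide field_simps)
qed

subsection \<open>Exponential moments of score differences\<close>

lemma sbm_T_diff:
  "sbm_T n lam A s' - sbm_T n lam A s =
     (\<Sum>p\<in>sbm_pairs n. ((if A p then 1 else 0) - lam) *
        ((if s' (fst p) = s' (snd p) then 1 else 0) - (if s (fst p) = s (snd p) then 1 else 0)))"
  unfolding sbm_T_def sum_distrib_left sum_subtractf[symmetric]
  by (intro sum.cong refl) (simp add: algebra_simps)

lemma finite_set_sbm_graph [simp]: "finite (set_pmf (sbm_graph n a b s))"
  unfolding sbm_graph_def by (rule finite_subset[OF set_Pi_pmf_subset']) auto

lemma integrable_sbm_graph [simp]:
  "integrable (measure_pmf (sbm_graph n a b s)) (f :: _ \<Rightarrow> real)"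
  by (rule integrable_measure_pmf_finite) simp

text \<open>The score difference is a sum over independent edges, so its exponential moment
  factorises. A pair merged by \<open>s'\<close> has coefficient 1 and edge probability
  \<open>b / n\<close>, a separated pair has coefficient -1 and edge probability
  \<open>a / n\<close>, and any other pair has coefficient 0 and contributes the factor 1.\<close>

lemma expectation_exp_sbm_T_diff:
  fixes n :: nat and a b t lam u v :: real
  assumes ab: "0 \<le> a / n" "a / n \<le> 1" "0 \<le> b / n" "b / n \<le> 1"
    and u: "b / n * exp (t * (1 - lam)) + (1 - b / n) * exp (- (t * lam)) = u"
    and v: "a / n * exp (- (t * (1 - lam))) + (1 - a / n) * exp (t * lam) = v"
  shows "measure_pmf.expectation (sbm_graph n a b s)
           (\<lambda>A. exp (t * (sbm_T n lam A s' - sbm_T n lam A s)))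
         = u ^ card (split_pairs n s' s) * v ^ card (split_pairs n s s')"
proof -
  define c :: "nat \<times> nat \<Rightarrow> real" where "c p = (if s' (fst p) = s' (snd p) then 1 else 0)
      - (if s (fst p) = s (snd p) then 1 else 0)" for p
  define f where "f p x = exp (t * (((if x then 1 else 0) - lam) * c p))" for p x
  define S1 where "S1 = split_pairs n s' s"
  define S2 where "S2 = split_pairs n s s'"
  define S0 where "S0 = sbm_pairs n - S1 - S2"
  have "measure_pmf.expectation (sbm_graph n a b s)
           (\<lambda>A. exp (t * (sbm_T n lam A s' - sbm_T n lam A s)))
      = measure_pmf.expectation (sbm_graph n a b s) (\<lambda>A. \<Prod>p\<in>sbm_pairs n. f p (A p))"
    unfolding sbm_T_diff f_def c_def by (simp add: sum_distrib_left exp_sum)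
  also have "\<dots> = (\<Prod>p\<in>sbm_pairs n.
      measure_pmf.expectation (bernoulli_pmf (sbm_theta n a b s p)) (f p))"
    unfolding sbm_graph_def
    by (rule expectation_prod_Pi_pmf) (auto simp: f_def intro!: integrable_measure_pmf_finite)
  also have "\<dots> = (\<Prod>p\<in>sbm_pairs n. sbm_theta n a b s p * f p True
      + (1 - sbm_theta n a b s p) * f p False)" (is "_ = prod ?g _")
    using ab by (intro prod.cong refl) (auto simp: sbm_theta_def)
  also have "sbm_pairs n = S1 \<union> (S2 \<union> S0)"
    by (auto simp: S0_def S1_def S2_def split_pairs_def)
  also have "prod ?g (S1 \<union> (S2 \<union> S0)) = prod ?g S1 * (prod ?g S2 * prod ?g S0)"
  proof -
    have "finite S0" "finite S1" "finite S2" by (simp_all add: S0_def S1_def S2_def)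
    moreover have "S1 \<inter> (S2 \<union> S0) = {}" "S2 \<inter> S0 = {}"
      by (auto simp: S0_def S1_def S2_def split_pairs_def)
    ultimately show ?thesis by (simp add: prod.union_disjoint)
  qed
  also have "prod ?g S1 = (\<Prod>p\<in>S1. u)"
    by (intro prod.cong refl)
      (auto simp: S1_def split_pairs_def sbm_theta_def f_def c_def u[symmetric])
  also have "prod ?g S2 = (\<Prod>p\<in>S2. v)"
    by (intro prod.cong refl)
      (auto simp: S2_def split_pairs_def sbm_theta_def f_def c_def v[symmetric] algebra_simps)
  also have "prod ?g S0 = 1"
    by (intro prod.neutral)
      (auto simp: S0_def S1_def S2_def split_pairs_def f_def c_def)
  finally show ?thesis by (simp add: S1_def S2_def)
qed

lemma sbm_tstar_pos:
  fixes n :: nat and a b :: real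
  assumes n: "0 < n" and ab: "0 < b" "b < a" "a < n"
  shows "0 < sbm_tstar n a b"
proof -
  have "0 < 1 - a / n" "1 - a / n < 1 - b / n"
    using assms by (auto simp: field_simps)
  then have "b * (1 - a / n) < a * (1 - b / n)" "0 < b * (1 - a / n)"
    using ab by (auto intro!: mult_strict_mono)
  then show ?thesis unfolding sbm_tstar_def by (auto intro!: ln_gt_zero)
qed

text \<open>With \<open>P\<close>, \<open>Q\<close> the two moment generating functions at \<open>t\<close>, the choice of \<open>t\<close> makes
  \<open>P * Q = exp (- I)\<close>; the penalty \<open>\<lambda>\<close> only decides how this factor is shared between the
  merged and the separated pairs, the case \<open>K = 2\<close> being the share \<open>1 / 2\<close>.\<close>
lemma sbm_lambda_shares:
  fixes n K :: nat and a b w :: real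
  assumes n: "0 < n" and ab: "0 < b" "b < a" "a < n" and w: "0 \<le> w" "w \<le> 1"
  defines "t \<equiv> sbm_tstar n a b" and "lam \<equiv> sbm_lambda n K a b w" and "I \<equiv> sbm_I n a b"
  obtains \<omega> where "0 \<le> \<omega>" "\<omega> \<le> 1"
    "b / n * exp (t * (1 - lam)) + (1 - b / n) * exp (- (t * lam)) = exp (- (\<omega> * I))"
    "a / n * exp (- (t * (1 - lam))) + (1 - a / n) * exp (t * lam) = exp (- ((1 - \<omega>) * I))"
proof -
  define p where "p = a / n"
  define q where "q = b / n"
  define P where "P = p * exp (- t) + (1 - p)"
  define Q where "Q = q * exp t + (1 - q)"
  have pq: "0 < q" "q < p" "p < 1" using n ab by (auto simp: p_def q_def field_simps)
  then have p0: "0 < p" "0 < 1 - p" "0 < 1 - q" by linarith+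
  have t0: "0 < t" unfolding t_def by (rule sbm_tstar_pos) (use n ab in auto)
  have P0: "0 < P" "0 < Q" using pq p0 by (auto simp: P_def Q_def intro!: add_pos_pos)
  define r where "r = (p * (1 - q)) / (q * (1 - p))"
  have r0: "0 < r" using pq p0 by (simp add: r_def)
  have "(a * (1 - b / n)) / (b * (1 - a / n)) = r"
  proof -
    have "a = n * p" "b = n * q" using n by (simp_all add: p_def q_def)
    then show ?thesis using n by (simp add: r_def mult.assoc)
  qed
  then have "t = ln r / 2" by (simp add: t_def sbm_tstar_def)
  then have et: "exp t = sqrt r" using r0 by (simp flip: ln_sqrt)
  \<comment> \<open>In terms of these square roots \<open>exp t\<close> is a rational expression and
    \<open>P * Q\<close> is the perfect square of \<open>x * y + x' * y'\<close>, whose logarithm is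
    \<open>- I / 2\<close>.\<close>
  define x where "x = sqrt p" define y where "y = sqrt q"
  define x' where "x' = sqrt (1 - p)" define y' where "y' = sqrt (1 - q)"
  have xy: "0 < x" "0 < y" "0 < x'" "0 < y'" using pq p0 by (simp_all add: x_def y_def x'_def y'_def)
  have xy2: "p = x\<^sup>2" "q = y\<^sup>2" "1 - p = x'\<^sup>2" "1 - q = y'\<^sup>2"
    using pq p0 by (simp_all add: x_def y_def x'_def y'_def)
  have et': "exp t = x * y' / (y * x')"
    unfolding et r_def x_def y_def x'_def y'_def by (simp add: real_sqrt_mult real_sqrt_divide)
  have "P * Q = (x\<^sup>2 * (y * x' / (x * y')) + x'\<^sup>2) * (y\<^sup>2 * (x * y' / (y * x')) + y'\<^sup>2)"
    unfolding P_def Q_def exp_minus et' xy2(3,4) by (simp add: xy2(1,2))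
  also have "\<dots> = (x * y + x' * y')\<^sup>2"
    using xy by (simp add: power2_eq_square field_simps)
  finally have PQ2: "P * Q = (x * y + x' * y')\<^sup>2" .
  have "I = - 2 * ln (x * y + x' * y')"
    unfolding I_def sbm_I_def x_def y_def x'_def y'_def p_def[symmetric] q_def[symmetric]
    by (simp add: real_sqrt_mult)
  also have "\<dots> = - ln (P * Q)"
    unfolding PQ2 using xy by (subst ln_realpow) (auto intro!: add_pos_pos)
  finally have I: "I = - (ln P + ln Q)" using P0 by (simp add: ln_mult)
  define \<omega> where "\<omega> = (if K = 2 then 1 / 2 else w)"
  have "t * lam = - (\<omega> * ln P) + (1 - \<omega>) * ln Q"
    using t0 unfolding lam_def sbm_lambda_def t_def[symmetric] p_def[symmetric] q_def[symmetric] Let_def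
    by (simp add: \<omega>_def P_def Q_def field_simps)
  \<comment> \<open>Equivalently \<open>t * lam = ln Q + \<omega> * I\<close>, so multiplying
    \<open>Q\<close> by \<open>exp (- (t * lam))\<close> leaves the share \<omega> of
    \<open>I\<close>, and multiplying \<open>P\<close> by \<open>exp (t * lam)\<close> leaves the
    rest.\<close>
  then have tl: "t * lam = - (\<omega> * ln P) + ln Q - \<omega> * ln Q" by (simp add: algebra_simps)
  show thesis
  proof (rule that)
    show "0 \<le> \<omega>" "\<omega> \<le> 1" using w by (auto simp: \<omega>_def)
    have "b / n * exp (t * (1 - lam)) + (1 - b / n) * exp (- (t * lam)) = Q * exp (- (t * lam))"
      by (simp add: Q_def q_def right_diff_distrib exp_diff exp_minus field_simps)
    also have "\<dots> = exp (ln Q) * exp (- (t * lam))" using P0 by simp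
    also have "\<dots> = exp (- (\<omega> * I))"
      unfolding exp_add[symmetric] tl I by (simp add: algebra_simps)
    finally show "b / n * exp (t * (1 - lam)) + (1 - b / n) * exp (- (t * lam)) = exp (- (\<omega> * I))" .
    have "a / n * exp (- (t * (1 - lam))) + (1 - a / n) * exp (t * lam) = P * exp (t * lam)"
      by (simp add: P_def p_def right_diff_distrib exp_diff exp_minus field_simps)
    also have "\<dots> = exp (ln P) * exp (t * lam)" using P0 by simp
    also have "\<dots> = exp (- ((1 - \<omega>) * I))"
      unfolding exp_add[symmetric] tl I by (simp add: algebra_simps)
    finally show "a / n * exp (- (t * (1 - lam))) + (1 - a / n) * exp (t * lam) = exp (- ((1 - \<omega>) * I))" .
  qed
qed

text \<open>The exponent is \<open>I\<close> times a convex combination of the merged and separated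
  counts. It is therefore at least \<open>I\<close> times any common lower bound of both, whatever
  the weight \<open>w\<close>.\<close>

lemma expectation_exp_sbm_T_diff_le:
  fixes n K :: nat and a b w B :: real
  assumes n: "0 < n" and ab: "0 < b" "b < a" "a < n" and w: "0 \<le> w" "w \<le> 1"
    and I: "0 \<le> sbm_I n a b"
    and B: "B \<le> real (card (split_pairs n s' s))" "B \<le> real (card (split_pairs n s s'))"
  shows "measure_pmf.expectation (sbm_graph n a b s)
           (\<lambda>A. exp (sbm_tstar n a b * (sbm_T n (sbm_lambda n K a b w) A s'
                                     - sbm_T n (sbm_lambda n K a b w) A s)))
         \<le> exp (- (sbm_I n a b * B))"
proof -
  define I where "I = sbm_I n a b"
  obtain \<omega> where \<omega>: "0 \<le> \<omega>" "\<omega> \<le> 1"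
    and u: "b / n * exp (sbm_tstar n a b * (1 - sbm_lambda n K a b w))
      + (1 - b / n) * exp (- (sbm_tstar n a b * sbm_lambda n K a b w)) = exp (- (\<omega> * I))"
    and v: "a / n * exp (- (sbm_tstar n a b * (1 - sbm_lambda n K a b w)))
      + (1 - a / n) * exp (sbm_tstar n a b * sbm_lambda n K a b w) = exp (- ((1 - \<omega>) * I))"
    using sbm_lambda_shares[OF n ab w] unfolding I_def by blast
  have 1: "0 \<le> a / n" "a / n \<le> 1" "0 \<le> b / n" "b / n \<le> 1" using n ab by (auto simp: field_simps)
  define \<gamma> where "\<gamma> = real (card (split_pairs n s' s))"
  define \<alpha> where "\<alpha> = real (card (split_pairs n s s'))"
  have "B = \<omega> * B + (1 - \<omega>) * B" by (simp add: algebra_simps)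
  also have "\<dots> \<le> \<omega> * \<gamma> + (1 - \<omega>) * \<alpha>"
    using B \<omega> by (intro add_mono mult_left_mono) (auto simp: \<gamma>_def \<alpha>_def)
  finally have "I * B \<le> I * (\<omega> * \<gamma> + (1 - \<omega>) * \<alpha>)"
    using I by (intro mult_left_mono) (auto simp: I_def)
  moreover have "exp (- (\<omega> * I)) ^ card (split_pairs n s' s) * exp (- ((1 - \<omega>) * I)) ^ card (split_pairs n s s')
      = exp (- (I * (\<omega> * \<gamma> + (1 - \<omega>) * \<alpha>)))"
    by (simp add: \<gamma>_def \<alpha>_def algebra_simps flip: exp_of_nat_mult exp_add)
  ultimately show ?thesis
    unfolding expectation_exp_sbm_T_diff[OF 1 u v] by (simp add: I_def)
qed

text \<open>The second square root alone exceeds \<epsilon>, since both \<open>1 - a / n\<close> and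
  \<open>1 - b / n\<close> do. A bounded \<open>I\<close> means that growth of
  \<open>n I / K\<close> forces growth of the mean community size \<open>n / K\<close>.\<close>

lemma sbm_I_le:
  fixes n :: nat and a b \<epsilon> :: real
  assumes n: "0 < n" and ab: "0 < b" "b < a" "a / n < 1 - \<epsilon>" and \<epsilon>: "0 < \<epsilon>"
  shows "sbm_I n a b \<le> - 2 * ln \<epsilon>"
proof -
  have ab': "\<epsilon> < 1 - a / n" "\<epsilon> < 1 - b / n"
    using n ab by (auto intro: less_trans[of "b / n" "a / n"] simp: divide_strict_right_mono
        less_diff_eq add.commute intro!: order_less_trans[OF add_strict_left_mono[of "b/n" "a/n" \<epsilon>]])
  then have "\<epsilon> * \<epsilon> \<le> (1 - a / n) * (1 - b / n)"
    using \<epsilon> by (intro mult_mono) auto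
  then have "sqrt (\<epsilon> * \<epsilon>) \<le> sqrt ((1 - a / n) * (1 - b / n))" by (rule real_sqrt_le_mono)
  then have "\<epsilon> \<le> sqrt ((1 - a / n) * (1 - b / n))" using \<epsilon> by simp
  moreover have "0 \<le> sqrt (a / n * (b / n))" using n ab by simp
  ultimately have "\<epsilon> \<le> sqrt (a / n * (b / n)) + sqrt ((1 - a / n) * (1 - b / n))" by linarith
  then show ?thesis unfolding sbm_I_def using \<epsilon> by simp
qed

subsection \<open>Optimal relabelling\<close>

lemma Theta0_relabel:
  assumes e: "e \<in> Theta0 n K h" and p: "p permutes {..<K}"
  shows "restrict (p \<circ> e) {..<n} \<in> Theta0 n K h"
proof -
  let ?s = "restrict (p \<circ> e) {..<n}"
  have e': "e \<in> {..<n} \<rightarrow>\<^sub>E {..<K}" using e by (simp add: Theta0_def)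
  have "?s \<in> {..<n} \<rightarrow>\<^sub>E {..<K}"
    using e' permutes_in_image[OF p] by (auto simp: PiE_iff)
  moreover have "{i. i < n \<and> ?s i = k} = {i. i < n \<and> e i = inv p k}" for k
    by (auto simp: permutes_inverses[OF p])
  moreover have "inv p k < K" if "k < K" for k
    using permutes_in_image[OF permutes_inv[OF p], of k] that by simp
  ultimately show ?thesis using e by (simp add: Theta0_def)
qed

text \<open>Relabelling the estimate optimally changes neither its score nor its class, so the risk
  may be read off assignments that need no further alignment with the truth.\<close>
lemma sbm_r_aligned:
  assumes e: "e \<in> Theta0 n K h"
  obtains s' where "s' \<in> Theta0 n K h"
    "sbm_r n K e s = real (card (disagreements n s' s)) / real n"
    "\<And>\<delta>. \<delta> permutes {..<K} \<Longrightarrow> card (disagreements n s' s) \<le> card (disagreements n s' (\<delta> \<circ> s))"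
    "\<And>lam A. sbm_T n lam A s' = sbm_T n lam A e"
proof -
  let ?P = "{\<delta>. \<delta> permutes {..<K}}"
  let ?g = "\<lambda>\<delta>. card {i. i < n \<and> e i \<noteq> \<delta> (s i)}"
  have fin: "finite ?P" by (simp add: finite_permutations)
  have ne: "?P \<noteq> {}" using permutes_id[of "{..<K}"] by blast
  have "Min (?g ` ?P) \<in> ?g ` ?P" using fin ne by (intro Min_in) auto
  then obtain p where p: "p permutes {..<K}" and gp: "?g p = Min (?g ` ?P)" by auto
  have gmin: "?g p \<le> ?g \<delta>" if "\<delta> permutes {..<K}" for \<delta>
    unfolding gp using fin that by (intro Min_le) auto
  have r: "sbm_r n K e s = real (?g p) / real n"
    unfolding sbm_r_def
  proof (rule Min_eqI)
    show "finite {real (?g \<delta>) / real n |\<delta>. \<delta> permutes {..<K}}"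
      using fin by (simp add: setcompr_eq_image)
    show "real (?g p) / real n \<in> {real (?g \<delta>) / real n |\<delta>. \<delta> permutes {..<K}}" using p by blast
    fix y assume "y \<in> {real (?g \<delta>) / real n |\<delta>. \<delta> permutes {..<K}}"
    then obtain \<delta> where "\<delta> permutes {..<K}" "y = real (?g \<delta>) / real n" by blast
    then show "real (?g p) / real n \<le> y" using gmin by (simp add: divide_right_mono)
  qed
  define s' where "s' = restrict (inv p \<circ> e) {..<n}"
  \<comment> \<open>Undoing \<open>p\<close> on the estimate instead of applying it to the truth
    preserves disagreements, so minimality at \<open>p\<close> becomes minimality at the
    identity.\<close>
  have dis: "disagreements n s' u = {i. i < n \<and> e i \<noteq> p (u i)}" for u
    by (auto simp: disagreements_def s'_def permutes_inv_eq[OF p])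
  show thesis
  proof (rule that)
    show "s' \<in> Theta0 n K h"
      unfolding s'_def by (rule Theta0_relabel[OF e permutes_inv[OF p]])
    show "sbm_r n K e s = real (card (disagreements n s' s)) / real n"
      by (simp add: r dis)
    show "card (disagreements n s' s) \<le> card (disagreements n s' (\<delta> \<circ> s))"
      if "\<delta> permutes {..<K}" for \<delta>
      using gmin[OF permutes_compose[OF that p]] by (simp add: dis)
    have same: "s' (fst q) = s' (snd q) \<longleftrightarrow> e (fst q) = e (snd q)" if "q \<in> sbm_pairs n" for q
      using that inj_eq[OF permutes_inj[OF permutes_inv[OF p]]]
      by (auto simp: s'_def sbm_pairs_def)
    show "sbm_T n lam A s' = sbm_T n lam A e" for lam A
      unfolding sbm_T_def by (simp add: same cong: sum.cong)
  qed
qed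

text \<open>A nontrivially relabelled copy of the truth lies at positive distance yet separates and
  merges no pair, so its exponential moment would not decay. Requiring the identity to be an optimal
  relabelling excludes such copies from the union bound.\<close>

definition aligned_assignments :: "nat \<Rightarrow> nat \<Rightarrow> real \<Rightarrow> (nat \<Rightarrow> nat) \<Rightarrow> (nat \<Rightarrow> nat) set" where
  "aligned_assignments n K h s = {s' \<in> Theta0 n K h. \<forall>\<delta>. \<delta> permutes {..<K} \<longrightarrow>
     card (disagreements n s' s) \<le> card (disagreements n s' (\<delta> \<circ> s))}"

lemma finite_Theta0 [simp]: "finite (Theta0 n K h)"
  by (rule finite_subset[of _ "{..<n} \<rightarrow>\<^sub>E {..<K}"]) (auto simp: Theta0_def intro!: finite_PiE)

lemma finite_aligned_assignments [simp]: "finite (aligned_assignments n K h s)"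
  by (rule finite_subset[of _ "Theta0 n K h"]) (auto simp: aligned_assignments_def)

text \<open>Close to the truth the constant must tend to 1 to give the sharp exponent, and direct
  counting provides this. Farther away a fixed fraction suffices, and the alignment argument
  provides it.\<close>

lemma card_split_pairs_ge:
  fixes n K :: nat and h \<zeta> :: real
  assumes s: "s \<in> Theta0 n K h" and t: "t \<in> Theta0 n K h" and K: "0 < K"
    and h: "\<bar>h\<bar> \<le> 1 / 6"
    and m: "\<And>\<delta>. \<delta> permutes {..<K} \<Longrightarrow> m \<le> card (disagreements n t (\<delta> \<circ> s))"
    and m_eq: "m = card (disagreements n s t)"
  defines "N \<equiv> real n / real K"
  shows "(if real m \<le> \<zeta> * N then (1 - h - \<zeta>) * N * m else N * m / 20)
      \<le> real (card (split_pairs n s t))"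
proof (cases "real m \<le> \<zeta> * N")
  case True
  have "(1 - h) * N \<le> real (card {j. j < n \<and> s j = s i})" if "i < n" for i
    using s that by (auto simp: Theta0_def N_def PiE_iff)
  then have "real m * ((1 - h) * N - real m) \<le> real (card (split_pairs n s t))"
    unfolding m_eq by (rule card_split_pairs_ge_near)
  moreover have "real m * ((1 - h - \<zeta>) * N) \<le> real m * ((1 - h) * N - real m)"
    using True by (intro mult_left_mono) (auto simp: algebra_simps)
  ultimately show ?thesis using True by (simp add: mult.commute)
next
  case False
  let ?c = "real (card (split_pairs n s t))"
  show ?thesis
  proof (cases "n = 0")
    case n: False
    have N0: "0 < N" using K n by (simp add: N_def)
    define L where "L = (1 - h) * N"
    define U where "U = (1 + h) * N"
    have st: "s i < K" "t i < K" if "i < n" for i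
      using s t that by (auto simp: Theta0_def PiE_iff)
    have L0: "0 \<le> L" "U < 2 * L" using h N0 by (auto simp: L_def U_def algebra_simps abs_le_iff)
    have "real m * (2 * L - U) * L \<le> 4 * U * ?c"
    proof (rule card_split_pairs_ge_aligned)
      show "L \<le> real (card {i. i < n \<and> s i = k})" if "k < K" for k
        using s that by (auto simp: Theta0_def L_def N_def)
      show "real (card {i. i < n \<and> s i = k}) \<le> U" if "k < K" for k
        using s that by (auto simp: Theta0_def U_def N_def)
      show "real (card {i. i < n \<and> t i = k}) \<le> U" if "k < K" for k
        using t that by (auto simp: Theta0_def U_def N_def)
    qed (use st L0 K m in auto)
    also have "4 * U * ?c = 4 * (1 + h) * ?c * N" by (simp add: U_def)
    finally have "real m * (1 - 3 * h) * (1 - h) * N * N \<le> 4 * (1 + h) * ?c * N"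
      by (simp add: L_def U_def algebra_simps)
    then have *: "real m * (1 - 3 * h) * (1 - h) * N \<le> 4 * (1 + h) * ?c"
      using N0 by (rule mult_right_le_imp_le)
    \<comment> \<open>Here \<open>2 * L - U\<close> is at least \<open>N / 2\<close>,
      \<open>L\<close> at least \<open>5 / 6 * N\<close> and \<open>4 * U\<close> at most
      \<open>14 / 3 * N\<close>. The resulting constant is \<open>5 / 56\<close>, which exceeds
      \<open>1 / 20\<close>.\<close>
    have "(1 / 2) * (5 / 6) \<le> (1 - 3 * h) * (1 - h)"
      using h by (intro mult_mono) (auto simp: abs_le_iff)
    then have "(1 / 2) * (5 / 6) * (real m * N) \<le> (1 - 3 * h) * (1 - h) * (real m * N)"
      using N0 by (intro mult_right_mono) auto
    also have "\<dots> \<le> 4 * (1 + h) * ?c" using * by (simp add: mult_ac)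
    also have "\<dots> \<le> (14 / 3) * ?c" using h by (intro mult_right_mono) auto
    finally show ?thesis using False N0 by (simp add: mult.commute)
  qed (simp add: N_def)
qed

subsection \<open>The union bound over distances\<close>

text \<open>The risk is bounded graph by graph before expectations are taken; this keeps the weight
  \<open>m / n\<close> on every term, which \<open>near_term_le\<close> exploits.\<close>

lemma expectation_sbm_r_le_sum:
  fixes n K :: nat and a b w h \<zeta> m0 N :: real and e :: "(nat \<times> nat \<Rightarrow> bool) \<Rightarrow> nat \<Rightarrow> nat"
  assumes n: "0 < n" and K: "0 < K" and ab: "0 < b" "b < a" "a < n" and w: "0 \<le> w" "w \<le> 1"
    and I: "0 \<le> sbm_I n a b" and h: "\<bar>h\<bar> \<le> 1 / 6" and m0: "0 \<le> m0"
    and s: "s \<in> Theta0 n K h"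
    and e: "\<And>A. e A \<in> Theta0 n K h"
    and emax: "\<And>A. sbm_T n (sbm_lambda n K a b w) A s \<le> sbm_T n (sbm_lambda n K a b w) A (e A)"
  defines "N \<equiv> real n / real K"
  shows "measure_pmf.expectation (sbm_graph n a b s) (\<lambda>A. sbm_r n K (e A) s)
    \<le> m0 / n + (\<Sum>m\<in>{1..n} \<inter> {m. m0 \<le> real m}. real m / n * ((exp 1 * n * K / m) ^ m
        * exp (- (sbm_I n a b * (if real m \<le> \<zeta> * N then (1 - h - \<zeta>) * N * m else N * m / 20)))))"
proof -
  define lam where "lam = sbm_lambda n K a b w"
  define t where "t = sbm_tstar n a b"
  define I where "I = sbm_I n a b"
  define B where "B m = (if real m \<le> \<zeta> * N then (1 - h - \<zeta>) * N * m else N * m / 20)" for m :: nat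
  define d where "d s' = card (disagreements n s' s)" for s'
  define F where "F = {s' \<in> aligned_assignments n K h s. m0 \<le> real (d s')}"
  define M where "M = {1..n} \<inter> {m. m0 \<le> real m}"
  have finF: "finite F" by (simp add: F_def)
  have t0: "0 < t" unfolding t_def by (rule sbm_tstar_pos[OF n ab])
  have pointwise: "sbm_r n K (e A) s \<le> m0 / n
      + (\<Sum>s'\<in>F. real (d s') / n * exp (t * (sbm_T n lam A s' - sbm_T n lam A s)))" for A
  proof -
    obtain s' where s': "s' \<in> Theta0 n K h"
      and r: "sbm_r n K (e A) s = real (d s') / real n"
      and al: "\<And>\<delta>. \<delta> permutes {..<K} \<Longrightarrow> d s' \<le> card (disagreements n s' (\<delta> \<circ> s))"
      and T: "\<And>lam A'. sbm_T n lam A' s' = sbm_T n lam A' (e A)"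
      unfolding d_def using sbm_r_aligned[OF e[of A], of s] by metis
    show ?thesis
    proof (cases "m0 \<le> real (d s')")
      case True
      then have "s' \<in> F" using s' al by (simp add: F_def aligned_assignments_def d_def)
      have "1 \<le> exp (t * (sbm_T n lam A s' - sbm_T n lam A s))"
        using t0 emax[of A] by (simp add: T lam_def)
      then have "real (d s') / n * 1 \<le> real (d s') / n * exp (t * (sbm_T n lam A s' - sbm_T n lam A s))"
        by (intro mult_left_mono) auto
      also have "\<dots> \<le> (\<Sum>s'\<in>F. real (d s') / n * exp (t * (sbm_T n lam A s' - sbm_T n lam A s)))"
        by (rule member_le_sum[OF \<open>s' \<in> F\<close>]) (auto simp: finF)
      also have "\<dots> \<le> m0 / n + \<dots>" using m0 by simp
      finally show ?thesis by (simp add: r)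
    next
      case False
      then have "sbm_r n K (e A) s \<le> m0 / n" unfolding r by (intro divide_right_mono) auto
      also have "\<dots> \<le> m0 / n
          + (\<Sum>s'\<in>F. real (d s') / n * exp (t * (sbm_T n lam A s' - sbm_T n lam A s)))"
        by (simp add: sum_nonneg)
      finally show ?thesis .
    qed
  qed
  have chernoff: "measure_pmf.expectation (sbm_graph n a b s)
      (\<lambda>A. exp (t * (sbm_T n lam A s' - sbm_T n lam A s))) \<le> exp (- (I * B (d s')))" if "s' \<in> F" for s'
  proof -
    have s': "s' \<in> Theta0 n K h"
      and al: "\<And>\<delta>. \<delta> permutes {..<K} \<Longrightarrow> d s' \<le> card (disagreements n s' (\<delta> \<circ> s))"
      using that by (auto simp: F_def aligned_assignments_def d_def)
    have sym: "disagreements n s s' = disagreements n s' s" by (auto simp: disagreements_def)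
    \<comment> \<open>Optimal labelling is a symmetric relation, because a permutation of one
      assignment can be inverted and moved to the other. The bound for merged pairs needs it with
      the roles exchanged.\<close>
    have al': "d s' \<le> card (disagreements n s (\<delta> \<circ> s'))" if p: "\<delta> permutes {..<K}" for \<delta>
    proof -
      have "disagreements n s (\<delta> \<circ> s') = disagreements n s' (inv \<delta> \<circ> s)"
        by (auto simp: disagreements_def permutes_inverses[OF p])
      then show ?thesis using al[OF permutes_inv[OF p]] by simp
    qed
    show ?thesis
      unfolding t_def lam_def I_def
    proof (rule expectation_exp_sbm_T_diff_le[OF n ab w I])
      show "B (d s') \<le> real (card (split_pairs n s s'))"
        unfolding B_def N_def by (rule card_split_pairs_ge[OF s s' K h al]) (simp_all add: d_def sym)
      show "B (d s') \<le> real (card (split_pairs n s' s))"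
        unfolding B_def N_def by (rule card_split_pairs_ge[OF s' s K h al']) (simp_all add: d_def)
    qed
  qed
  have "measure_pmf.expectation (sbm_graph n a b s) (\<lambda>A. sbm_r n K (e A) s)
      \<le> measure_pmf.expectation (sbm_graph n a b s) (\<lambda>A. m0 / n
      + (\<Sum>s'\<in>F. real (d s') / n * exp (t * (sbm_T n lam A s' - sbm_T n lam A s))))"
    by (intro integral_mono pointwise) auto
  also have "\<dots> = m0 / n + (\<Sum>s'\<in>F. real (d s') / n * measure_pmf.expectation (sbm_graph n a b s)
      (\<lambda>A. exp (t * (sbm_T n lam A s' - sbm_T n lam A s))))"
    by (simp add: Bochner_Integration.integral_sum Bochner_Integration.integral_add)
  also have "\<dots> \<le> m0 / n + (\<Sum>s'\<in>F. real (d s') / n * exp (- (I * B (d s'))))"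
    by (intro add_left_mono sum_mono mult_left_mono chernoff) auto
  also have "(\<Sum>s'\<in>F. real (d s') / n * exp (- (I * B (d s'))))
      = (\<Sum>s'\<in>{s' \<in> F. d s' \<in> M}. real (d s') / n * exp (- (I * B (d s'))))"
  \<comment> \<open>A member of \<open>F\<close> whose distance is outside \<open>M\<close> has
    distance 0, and then the factor \<open>d s' / n\<close> vanishes.\<close>
  proof (rule sum.mono_neutral_right[OF finF])
    have "d s' \<le> n" for s' by (simp add: d_def card_disagreements_le)
    moreover have "m0 \<le> real (d s')" if "s' \<in> F" for s' using that by (simp add: F_def)
    ultimately show "\<forall>s'\<in>F - {s' \<in> F. d s' \<in> M}. real (d s') / n * exp (- (I * B (d s'))) = 0"
      by (auto simp: M_def not_less_eq_eq)
  qed auto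
  also have "\<dots> = (\<Sum>m\<in>M. \<Sum>s'\<in>{s' \<in> {s' \<in> F. d s' \<in> M}. d s' = m}.
      real (d s') / n * exp (- (I * B (d s'))))"
    by (rule sum.group[symmetric]) (auto simp: finF M_def)
  also have "\<dots> \<le> (\<Sum>m\<in>M. real m / n * ((exp 1 * n * K / m) ^ m * exp (- (I * B m))))"
  proof (rule sum_mono)
    fix m assume m: "m \<in> M"
    let ?G = "{s' \<in> {s' \<in> F. d s' \<in> M}. d s' = m}"
    let ?H = "{s' \<in> {..<n} \<rightarrow>\<^sub>E {..<K}. d s' = m}"
    have "card ?G \<le> card ?H"
      by (rule card_mono)
        (auto simp: F_def aligned_assignments_def Theta0_def intro!: finite_PiE)
    also have "\<dots> \<le> (n choose m) * K ^ m"
      unfolding d_def by (rule card_assignments_disagreements_le)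
    finally have "real (card ?G) \<le> real ((n choose m) * K ^ m)" by (rule of_nat_mono)
    also have "\<dots> = real (n choose m) * real K ^ m" by simp
    also have "\<dots> \<le> (exp 1 * n / m) ^ m * real K ^ m"
      using m by (intro mult_right_mono binomial_le_exp_power) (auto simp: M_def)
    also have "\<dots> = (exp 1 * n * K / m) ^ m" by (simp flip: power_mult_distrib)
    finally have c: "real (card ?G) \<le> (exp 1 * n * K / m) ^ m" .
    have "(\<Sum>s'\<in>?G. real (d s') / n * exp (- (I * B (d s'))))
        = (\<Sum>s'\<in>?G. real m / n * exp (- (I * B m)))"
      by (rule sum.cong) auto
    also have "\<dots> = real (card ?G) * (real m / n * exp (- (I * B m)))" by simp
    also have "\<dots> \<le> (exp 1 * n * K / m) ^ m * (real m / n * exp (- (I * B m)))"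
      using c by (intro mult_right_mono) auto
    finally show "(\<Sum>s'\<in>?G. real (d s') / n * exp (- (I * B (d s'))))
        \<le> real m / n * ((exp 1 * n * K / m) ^ m * exp (- (I * B m)))"
      by (simp add: mult_ac)
  qed
  finally show ?thesis
    by (simp add: M_def B_def I_def)
qed

section \<open>Geometric bounds for near and far distances\<close>

lemma sum_power_half_le:
  "(\<Sum>m\<in>{1..n::nat}. (1 / 2 :: real) ^ (m - 1)) \<le> 2"
proof -
  have "(\<Sum>m\<in>{1..n}. (1 / 2 :: real) ^ (m - 1)) = (\<Sum>m<n. (1 / 2) ^ m)"
    by (rule sum.reindex_bij_witness[of _ Suc "\<lambda>m. m - 1"]) auto
  also have "\<dots> \<le> 2" by (simp add: sum_gp_strict)
  finally show ?thesis .
qed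

text \<open>The factor \<open>m / n\<close> of the risk turns one factor \<open>e n K / m\<close> into \<open>e K\<close>, which is why no case
  distinction between \<open>n I / K\<close> and \<open>log n\<close> is needed.\<close>
lemma near_term_le:
  fixes n K m :: nat and c :: real
  assumes n: "0 < n" and m: "0 < m" and m0: "2 * exp 1 * n * K * exp (- c) \<le> real m"
  shows "real m / n * ((exp 1 * n * K / m) ^ m * exp (- (c * m)))
    \<le> exp 1 * K * exp (- c) * (1 / 2) ^ (m - 1)"
proof -
  define x where "x = exp 1 * n * K * exp (- c) / m"
  have x: "0 \<le> x" "x \<le> 1 / 2" using m m0 by (simp_all add: x_def pos_divide_le_eq)
  have "exp (- (c * m)) = exp (- c) ^ m" using exp_of_nat_mult[of m "- c"] by (simp add: mult.commute)
  then have "(exp 1 * n * K / m) ^ m * exp (- (c * m)) = (exp 1 * n * K / m * exp (- c)) ^ m"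
    by (simp only: power_mult_distrib)
  also have "exp 1 * n * K / m * exp (- c) = x" by (simp add: x_def)
  also have "x ^ m = x * x ^ (m - 1)" using m by (cases m) auto
  finally have "real m / n * ((exp 1 * n * K / m) ^ m * exp (- (c * m)))
      = (real m / n * x) * x ^ (m - 1)" by simp
  also have "real m / n * x = exp 1 * K * exp (- c)" using n m by (simp add: x_def)
  also have "\<dots> * x ^ (m - 1) \<le> \<dots> * (1 / 2) ^ (m - 1)"
    using x by (intro mult_left_mono power_mono) auto
  finally show ?thesis .
qed

text \<open>As \<open>n / m\<close> is below \<open>K / \<zeta>\<close>, the counting base is at
  most \<open>e K^2 / \<zeta>\<close>, hence at most \<open>exp (X / 40)\<close>, and costs half of
  the exponent \<open>X m / 20\<close>. The remaining \<open>X m / 40\<close> is halved again: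
  \<open>m \<ge> 80\<close> turns one half into \<open>X\<close>, and \<open>X \<ge> 80 ln 2\<close>
  turns the other into \<open>m ln 2\<close>.\<close>

lemma far_term_le:
  fixes n K m :: nat and X \<zeta> :: real
  assumes n: "0 < n" and m: "0 < m" "m \<le> n" and K: "0 < K" and \<zeta>: "0 < \<zeta>"
    and far: "\<zeta> * (real n / real K) < m" and big: "80 \<le> real m" "80 * ln 2 \<le> X"
    and log: "1 + 2 * ln (real K) - ln \<zeta> \<le> X / 40"
  shows "real m / n * ((exp 1 * n * K / m) ^ m * exp (- (X * m / 20))) \<le> exp (- X) * (1 / 2) ^ (m - 1)"
proof -
  have "real n = \<zeta> * (real n / real K) * (real K / \<zeta>)" using K \<zeta> by simp
  also have "\<dots> \<le> m * (real K / \<zeta>)" using far \<zeta> by (intro mult_right_mono) auto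
  finally have "real n / m \<le> real K / \<zeta>" using m by (simp add: pos_divide_le_eq mult.commute)
  then have "exp 1 * K * (real n / m) \<le> exp 1 * K * (real K / \<zeta>)"
    by (intro mult_left_mono) auto
  then have "exp 1 * n * K / m \<le> exp 1 * K * K / \<zeta>"
    by (simp add: mult_ac)
  also have "exp 1 * K * K / \<zeta> = exp (1 + ln (real K) + ln (real K) - ln \<zeta>)"
    unfolding exp_add exp_diff using K \<zeta> by simp
  also have "\<dots> \<le> exp (X / 40)" using log by simp
  finally have "exp 1 * n * K / m \<le> exp (X / 40)" .
  then have "(exp 1 * n * K / m) ^ m \<le> exp (X / 40) ^ m" by (intro power_mono) auto
  also have "\<dots> = exp (X * m / 40)" using exp_of_nat_mult[of m "X / 40"] by (simp add: mult.commute)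
  finally have "(exp 1 * n * K / m) ^ m * exp (- (X * m / 20)) \<le> exp (X * m / 40) * exp (- (X * m / 20))"
    by (intro mult_right_mono) auto
  also have "\<dots> = exp (- (X * m / 40))" unfolding exp_add[symmetric] by simp
  also have "\<dots> \<le> exp (- X - m * ln 2)"
  proof -
    have "0 < ln (2 :: real)" by simp
    then have X0: "0 \<le> X" using big by linarith
    have "X * 80 \<le> X * m" using big X0 by (intro mult_left_mono) auto
    moreover have "80 * ln 2 * m \<le> X * m" using big by (intro mult_right_mono) auto
    ultimately have "- (X * m / 40) \<le> - X - m * ln 2" by (simp add: mult_ac)
    then show ?thesis by simp
  qed
  also have "\<dots> = exp (- X) * (1 / 2) ^ m"
  proof -
    have "exp (- X - m * ln 2) = exp (- X) * exp (m * - ln 2)" by (simp flip: exp_add)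
    also have "exp (m * - ln 2) = exp (- ln 2 :: real) ^ m" by (rule exp_of_nat_mult)
    also have "exp (- ln 2 :: real) = 1 / 2" by (simp add: exp_minus)
    finally show ?thesis .
  qed
  also have "\<dots> \<le> exp (- X) * (1 / 2) ^ (m - 1)"
    by (intro mult_left_mono power_decreasing) auto
  finally have "(exp 1 * n * K / m) ^ m * exp (- (X * m / 20)) \<le> exp (- X) * (1 / 2) ^ (m - 1)" .
  moreover have "real m / n * ((exp 1 * n * K / m) ^ m * exp (- (X * m / 20)))
      \<le> (exp 1 * n * K / m) ^ m * exp (- (X * m / 20))"
    using m n by (intro mult_left_le_one_le) auto
  ultimately show ?thesis by linarith
qed

text \<open>Half of the loss \<epsilon> pays for \<open>h\<close> and \<zeta>, each at most
  \<open>\<epsilon> / 4\<close>; the other half absorbs the factor \<open>6 * exp 1 * K\<close>. The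
  hypothesis \<open>N\<close> makes every far distance exceed 80, as \<open>far_term_le\<close>
  requires.\<close>

lemma expectation_sbm_r_le:
  fixes n K :: nat and a b w h \<epsilon> X :: real and e :: "(nat \<times> nat \<Rightarrow> bool) \<Rightarrow> nat \<Rightarrow> nat"
  assumes n: "0 < n" and K: "0 < K" and ab: "0 < b" "b < a" "a < n" and w: "0 \<le> w" "w \<le> 1"
    and s: "s \<in> Theta0 n K h"
    and e: "\<And>A. e A \<in> Theta0 n K h"
    and emax: "\<And>A. sbm_T n (sbm_lambda n K a b w) A s \<le> sbm_T n (sbm_lambda n K a b w) A (e A)"
    and \<epsilon>: "0 < \<epsilon>" "\<epsilon> < 1" and h: "\<bar>h\<bar> \<le> 1 / 6" "\<bar>h\<bar> \<le> \<epsilon> / 4"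
  defines "X \<equiv> real n * sbm_I n a b / real K"
  assumes X: "80 * ln 2 \<le> X" "1 + 2 * ln (real K) - ln (\<epsilon> / 4) \<le> X / 40"
    "ln (6 * exp 1 * K) \<le> \<epsilon> / 2 * X"
    and N: "80 \<le> \<epsilon> / 4 * (real n / real K)"
  shows "measure_pmf.expectation (sbm_graph n a b s) (\<lambda>A. sbm_r n K (e A) s) \<le> exp (- ((1 - \<epsilon>) * X))"
proof -
  define N where "N = real n / real K"
  define I where "I = sbm_I n a b"
  define \<zeta> where "\<zeta> = \<epsilon> / 4"
  define c where "c = (1 - \<epsilon> / 2) * X"
  \<comment> \<open>From \<open>m0\<close> on, \<open>exp 1 * n * K * exp (- c) / m\<close> is at
    most \<open>1 / 2\<close>, the ratio of the geometric series.\<close>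
  define m0 where "m0 = 2 * exp 1 * n * K * exp (- c)"
  define B where "B m = (if real m \<le> \<zeta> * N then (1 - h - \<zeta>) * N * m else N * m / 20)" for m :: nat
  have "0 < ln (2 :: real)" by simp
  then have X0: "0 < X" using X(1) by linarith
  have XI: "X = I * N" by (simp add: X_def I_def N_def)
  have N0: "0 < N" using n K by (simp add: N_def)
  have I0: "0 \<le> I" using X0 N0 unfolding XI by (simp add: zero_less_mult_iff)
  have m0: "0 \<le> m0" by (simp add: m0_def)
  have "measure_pmf.expectation (sbm_graph n a b s) (\<lambda>A. sbm_r n K (e A) s)
    \<le> m0 / n + (\<Sum>m\<in>{1..n} \<inter> {m. m0 \<le> real m}. real m / n * ((exp 1 * n * K / m) ^ m
        * exp (- (I * B m))))"
    unfolding B_def N_def I_def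
    by (rule expectation_sbm_r_le_sum[OF n K ab w I0[unfolded I_def] h(1) m0 s e emax])
  also have "\<dots> \<le> m0 / n + (\<Sum>m\<in>{1..n}. (exp 1 * K * exp (- c) + exp (- X)) * (1 / 2) ^ (m - 1))"
  proof (rule add_left_mono)
    have "(\<Sum>m\<in>{1..n} \<inter> {m. m0 \<le> real m}. real m / n * ((exp 1 * n * K / m) ^ m * exp (- (I * B m))))
      \<le> (\<Sum>m\<in>{1..n} \<inter> {m. m0 \<le> real m}. (exp 1 * K * exp (- c) + exp (- X)) * (1 / 2) ^ (m - 1))"
    proof (rule sum_mono)
      fix m assume m: "m \<in> {1..n} \<inter> {m. m0 \<le> real m}"
      have near: "real m / n * ((exp 1 * n * K / m) ^ m * exp (- (I * B m)))
          \<le> exp 1 * K * exp (- c) * (1 / 2) ^ (m - 1)" if "real m \<le> \<zeta> * N"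
      proof -
        have "(1 - \<epsilon> / 2) * (X * m) \<le> (1 - h - \<zeta>) * (X * m)"
          using h \<epsilon> X0 by (intro mult_right_mono) (auto simp: \<zeta>_def abs_le_iff)
        then have "exp (- (I * B m)) \<le> exp (- (c * m))"
          using that by (simp add: B_def c_def XI mult_ac)
        then have "real m / n * ((exp 1 * n * K / m) ^ m * exp (- (I * B m)))
            \<le> real m / n * ((exp 1 * n * K / m) ^ m * exp (- (c * m)))"
          by (intro mult_left_mono) auto
        also have "\<dots> \<le> exp 1 * K * exp (- c) * (1 / 2) ^ (m - 1)"
          by (rule near_term_le) (use n m in \<open>auto simp: m0_def\<close>)
        finally show ?thesis .
      qed
      have far: "real m / n * ((exp 1 * n * K / m) ^ m * exp (- (I * B m)))
          \<le> exp (- X) * (1 / 2) ^ (m - 1)" if "\<not> real m \<le> \<zeta> * N"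
      proof -
        have "I * B m = X * m / 20" using that by (simp add: B_def XI)
        moreover have "real m / n * ((exp 1 * n * K / m) ^ m * exp (- (X * m / 20)))
            \<le> exp (- X) * (1 / 2) ^ (m - 1)"
          by (rule far_term_le[where \<zeta> = \<zeta>])
            (use n m K \<epsilon> that X N in \<open>auto simp: \<zeta>_def N_def\<close>)
        ultimately show ?thesis by (simp only:)
      qed
      have nonneg: "0 \<le> exp 1 * K * exp (- c) * (1 / 2) ^ (m - 1)" "0 \<le> exp (- X) * (1 / 2 :: real) ^ (m - 1)"
        by simp_all
      show "real m / n * ((exp 1 * n * K / m) ^ m * exp (- (I * B m)))
          \<le> (exp 1 * K * exp (- c) + exp (- X)) * (1 / 2) ^ (m - 1)"
        unfolding distrib_right using near far nonneg by linarith
    qed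
    also have "\<dots> \<le> (\<Sum>m\<in>{1..n}. (exp 1 * K * exp (- c) + exp (- X)) * (1 / 2) ^ (m - 1))"
      by (rule sum_mono2) auto
    finally show "(\<Sum>m\<in>{1..n} \<inter> {m. m0 \<le> real m}. real m / n * ((exp 1 * n * K / m) ^ m * exp (- (I * B m))))
      \<le> (\<Sum>m\<in>{1..n}. (exp 1 * K * exp (- c) + exp (- X)) * (1 / 2) ^ (m - 1))" .
  qed
  also have "\<dots> = m0 / n + (exp 1 * K * exp (- c) + exp (- X)) * (\<Sum>m\<in>{1..n}. (1 / 2) ^ (m - 1))"
    by (simp add: sum_distrib_left)
  also have "\<dots> \<le> m0 / n + (exp 1 * K * exp (- c) + exp (- X)) * 2"
    by (intro add_left_mono mult_left_mono sum_power_half_le) auto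
  also have "m0 / n = 2 * exp 1 * K * exp (- c)" using n by (simp add: m0_def)
  \<comment> \<open>The cutoff, the near sum and the far sum each contribute at most
    \<open>2 * exp 1 * K * exp (- c)\<close>, which gives the constant 6.\<close>
  also have "2 * exp 1 * K * exp (- c) + (exp 1 * K * exp (- c) + exp (- X)) * 2 \<le> 6 * exp 1 * K * exp (- c)"
  proof -
    have "exp (- X) \<le> exp (- c)" using X0 \<epsilon> by (simp add: c_def algebra_simps)
    moreover have "1 * 1 \<le> exp 1 * real K" using K by (intro mult_mono) auto
    then have "1 * exp (- c) \<le> exp 1 * K * exp (- c)" by (intro mult_right_mono) auto
    ultimately have "exp (- X) \<le> exp 1 * K * exp (- c)" by linarith
    then show ?thesis by (simp add: mult_ac)
  qed
  also have "\<dots> = exp (ln (6 * exp 1 * K) - c)"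
    using K by (simp add: exp_diff exp_minus field_simps)
  also have "\<dots> \<le> exp (- ((1 - \<epsilon>) * X))"
    using X(3) by (simp add: c_def algebra_simps)
  finally show ?thesis .
qed

subsection \<open>The asymptotic statement\<close>

text \<open>A diagonal choice: at \<open>n\<close> take the largest \<open>j \<le> n\<close> for
  which \<open>P\<close> holds with \<open>1 / (j + 1)\<close>. The cap keeps the candidates finite,
  \<open>j = 0\<close> is always among them by \<open>P1\<close>, and each fixed index eventually
  is.\<close>

lemma eventually_imp_vanishing_witness:
  fixes P :: "nat \<Rightarrow> real \<Rightarrow> bool"
  assumes P1: "\<And>n. P n 1" and ev: "\<And>\<epsilon>. 0 < \<epsilon> \<Longrightarrow> \<epsilon> < 1 \<Longrightarrow> eventually (\<lambda>n. P n \<epsilon>) sequentially"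
  obtains \<delta> where "\<delta> \<longlonglongrightarrow> 0" "\<And>n. P n (\<delta> n)"
proof -
  define J where "J n = {j. j \<le> n \<and> P n (inverse (real (Suc j)))}" for n
  define \<delta> where "\<delta> n = inverse (real (Suc (Max (J n))))" for n
  have fin: "finite (J n)" for n by (simp add: J_def)
  have "0 \<in> J n" for n using P1 by (simp add: J_def)
  then have "Max (J n) \<in> J n" for n using fin by (intro Max_in) auto
  then have P: "P n (\<delta> n)" for n by (simp add: J_def \<delta>_def)
  have "\<delta> \<longlonglongrightarrow> 0"
  proof (rule LIMSEQ_I)
    fix r :: real assume "0 < r"
    \<comment> \<open>The index must be positive because \<open>ev\<close> covers only values below
      1.\<close>
    then obtain k where k: "inverse (real (Suc k)) < r" "k > 0"
    proof -
      obtain j where j: "inverse (real (Suc j)) < r" using reals_Archimedean[OF \<open>0 < r\<close>] by blast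
      have "inverse (real (Suc (Suc j))) \<le> inverse (real (Suc j))"
        by (intro le_imp_inverse_le) auto
      from le_less_trans[OF this j] show thesis using that[of "Suc j"] by simp
    qed
    have "inverse (real (Suc k)) < 1" using k(2) by (simp add: inverse_less_1_iff)
    then have "eventually (\<lambda>n. P n (inverse (real (Suc k))) \<and> k \<le> n) sequentially"
      by (intro eventually_conj ev eventually_ge_at_top) auto
    then obtain n0 where n0: "\<And>n. n0 \<le> n \<Longrightarrow> k \<in> J n"
      by (auto simp: J_def eventually_at_top_linorder)
    have "norm (\<delta> n - 0) < r" if "n0 \<le> n" for n
    proof -
      have "k \<le> Max (J n)" using fin n0[OF that] by (rule Max_ge)
      then have "\<delta> n \<le> inverse (real (Suc k))"
        unfolding \<delta>_def by (intro le_imp_inverse_le) auto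
      moreover have "0 < \<delta> n" by (simp add: \<delta>_def)
      ultimately show ?thesis using k by simp
    qed
    then show "\<exists>n0. \<forall>n\<ge>n0. norm (\<delta> n - 0) < r" by blast
  qed
  then show thesis using P that by blast
qed

theorem theorem5:
  fixes \<epsilon>0 w :: real and \<eta> a b :: "nat \<Rightarrow> real" and K :: "nat \<Rightarrow> nat"
    and est :: "nat \<Rightarrow> (nat \<times> nat \<Rightarrow> bool) \<Rightarrow> (nat \<Rightarrow> nat)"
  assumes eps0: "\<epsilon>0 > 0"
    and eta: "\<eta> \<longlonglongrightarrow> 0"
    and K2: "\<And>n. K n \<ge> 2"
    and ab: "\<And>n. \<epsilon>0 < b n \<and> b n < a n"
    and an: "\<And>n. a n / real n < 1 - \<epsilon>0"
    and growth: "filterlim (\<lambda>n. real n * sbm_I n (a n) (b n) / (real (K n) * ln (real (K n))))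
                   at_top sequentially"
    and w: "0 \<le> w" "w \<le> 1"
    and est: "\<And>n A. Theta0 n (K n) (\<eta> n) \<noteq> {} \<Longrightarrow>
                est n A \<in> Theta0 n (K n) (\<eta> n) \<and>
                (\<forall>\<sigma>\<in>Theta0 n (K n) (\<eta> n).
                   sbm_T n (sbm_lambda n (K n) (a n) (b n) w) A \<sigma>
                   \<le> sbm_T n (sbm_lambda n (K n) (a n) (b n) w) A (est n A))"
  shows "\<exists>\<delta> :: nat \<Rightarrow> real. \<delta> \<longlonglongrightarrow> 0 \<and>
           (\<forall>n. \<forall>\<sigma>\<in>Theta0 n (K n) (\<eta> n).
              measure_pmf.expectation (sbm_graph n (a n) (b n) \<sigma>)
                 (\<lambda>A. sbm_r n (K n) (est n A) \<sigma>)
              \<le> exp (- (1 + \<delta> n) * (real n * sbm_I n (a n) (b n) / real (K n))))"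
proof -
  define X where "X n = real n * sbm_I n (a n) (b n) / real (K n)" for n
  define P where "P n x \<longleftrightarrow> (\<forall>\<sigma>\<in>Theta0 n (K n) (\<eta> n).
      measure_pmf.expectation (sbm_graph n (a n) (b n) \<sigma>) (\<lambda>A. sbm_r n (K n) (est n A) \<sigma>)
      \<le> exp (- ((1 - x) * X n)))" for n x
  \<comment> \<open>With loss 1 the claim is merely that the risk is at most 1. This serves the
    initial \<open>n\<close>, where the eventual bound says nothing.\<close>
  have P1: "P n 1" for n
  proof -
    have "measure_pmf.expectation (sbm_graph n (a n) (b n) \<sigma>) (\<lambda>A. sbm_r n (K n) (est n A) \<sigma>) \<le> 1"
      if \<sigma>: "\<sigma> \<in> Theta0 n (K n) (\<eta> n)" for \<sigma>
    proof -
      have "sbm_r n (K n) (est n A) \<sigma> \<le> 1" for A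
      proof -
        have "est n A \<in> Theta0 n (K n) (\<eta> n)" using est \<sigma> by blast
        then obtain s' where "sbm_r n (K n) (est n A) \<sigma> = real (card (disagreements n s' \<sigma>)) / real n"
          using sbm_r_aligned by metis
        then show ?thesis using card_disagreements_le[of n s' \<sigma>] by (auto simp: divide_le_eq_1)
      qed
      then have "measure_pmf.expectation (sbm_graph n (a n) (b n) \<sigma>) (\<lambda>A. sbm_r n (K n) (est n A) \<sigma>)
          \<le> measure_pmf.expectation (sbm_graph n (a n) (b n) \<sigma>) (\<lambda>A. 1)"
        by (intro integral_mono) auto
      then show ?thesis by simp
    qed
    then show ?thesis by (simp add: P_def)
  qed
  \<comment> \<open>Division by zero yields 0, so the bound on \<open>a n / n\<close> at
    \<open>n = 0\<close> reads \<open>0 < 1 - \<epsilon>0\<close>.\<close>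
  have eps1: "\<epsilon>0 < 1" using an[of 0] by simp
  define C0 where "C0 = - 2 * ln \<epsilon>0"
  have C0: "0 < C0" using eps0 eps1 by (simp add: C0_def ln_less_zero)
  have ev: "eventually (\<lambda>n. P n \<epsilon>) sequentially" if \<epsilon>: "0 < \<epsilon>" "\<epsilon> < 1" for \<epsilon>
  proof -
    define C where "C = - ln (\<epsilon> / 4)"
    have C: "0 < C" using \<epsilon> by (simp add: C_def ln_less_zero)
    \<comment> \<open>The four nonnegative summands are the thresholds for \<open>X1\<close>,
      \<open>X2\<close>, \<open>X3\<close> and \<open>N\<close> in turn; in the last, 640 becomes
      320 through \<open>ln K \<ge> 1 / 2\<close>.\<close>
    define Y where "Y = 80 + 40 * (4 + 2 * C) + 2 / \<epsilon> * (3 + 2 * ln 6) + 640 * C0 / \<epsilon>"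
    have Y: "80 \<le> Y" "40 * (4 + 2 * C) \<le> Y" "2 / \<epsilon> * (3 + 2 * ln 6) \<le> Y" "640 * C0 / \<epsilon> \<le> Y"
      unfolding Y_def using C C0 \<epsilon> by (auto intro!: add_nonneg_nonneg)
    have e1: "eventually (\<lambda>n. Y \<le> real n * sbm_I n (a n) (b n) / (real (K n) * ln (real (K n)))) sequentially"
      using growth by (simp add: filterlim_at_top)
    have "0 < min (1 / 6) (\<epsilon> / 4)" using \<epsilon> by simp
    from tendstoD[OF eta this]
    have e2: "eventually (\<lambda>n. \<bar>\<eta> n\<bar> < min (1 / 6) (\<epsilon> / 4)) sequentially" by simp
    show ?thesis
      using e1 e2 eventually_gt_at_top[of 0]
    proof eventually_elim
      case (elim n)
      have n: "0 < n" and h: "\<bar>\<eta> n\<bar> \<le> 1 / 6" "\<bar>\<eta> n\<bar> \<le> \<epsilon> / 4" using elim by auto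
      have K: "0 < K n" using K2[of n] by simp
      have lK: "ln 2 \<le> ln (real (K n))" using K2[of n] by simp
      \<comment> \<open>Additive constants can now be absorbed into multiples of
        \<open>ln K\<close>, the scale on which the growth hypothesis controls
        \<open>X n\<close>.\<close>
      have lK': "1 / 2 \<le> ln (real (K n))" using lK ln2_ge_two_thirds by linarith
      have "Y \<le> X n / ln (real (K n))" using elim(1) by (simp add: X_def)
      then have XY: "Y * ln (real (K n)) \<le> X n" using lK' by (simp add: pos_le_divide_eq)
      have XY': "y * ln (real (K n)) \<le> X n" if "y \<le> Y" for y
        using mult_right_mono[OF that, of "ln (real (K n))"] XY lK' by linarith
      have "a n / n < 1" using an[of n] eps0 by linarith
      then have ab': "0 < b n" "b n < a n" "a n < n" "a n / n < 1 - \<epsilon>0"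
        using ab[of n] an[of n] eps0 n by (auto simp: pos_divide_less_eq)
      have X1: "80 * ln 2 \<le> X n" using XY'[OF Y(1)] lK by linarith
      have X2: "1 + 2 * ln (real (K n)) - ln (\<epsilon> / 4) \<le> X n / 40"
      proof -
        have "C * 1 \<le> C * (2 * ln (real (K n)))" using C lK' by (intro mult_left_mono) auto
        then have "1 + 2 * ln (real (K n)) + C \<le> (4 + 2 * C) * ln (real (K n))"
          using lK' by (simp add: algebra_simps)
        also have "\<dots> \<le> X n / 40" using XY'[OF Y(2)] by (simp add: algebra_simps)
        finally show ?thesis by (simp add: C_def)
      qed
      have X3: "ln (6 * exp 1 * real (K n)) \<le> \<epsilon> / 2 * X n"
      proof -
        have "ln (6 * exp 1 * real (K n)) = ln 6 + 1 + ln (real (K n))"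
          using K by (simp add: ln_mult)
        also have "\<dots> \<le> (3 + 2 * ln 6) * ln (real (K n))"
        proof -
          have "1 * ln 6 \<le> 2 * ln (real (K n)) * ln 6" using lK' by (intro mult_right_mono) auto
          then have "ln 6 \<le> 2 * ln 6 * ln (real (K n))" by (simp only: mult_ac mult_1)
          then show ?thesis unfolding distrib_right using lK' by linarith
        qed
        also have "\<dots> = \<epsilon> / 2 * (2 / \<epsilon> * (3 + 2 * ln 6) * ln (real (K n)))" using \<epsilon> by simp
        also have "\<dots> \<le> \<epsilon> / 2 * X n" using XY'[OF Y(3)] \<epsilon> by (intro mult_left_mono) auto
        finally show ?thesis .
      qed
      have N: "80 \<le> \<epsilon> / 4 * (real n / real (K n))"
      proof -
        have "sbm_I n (a n) (b n) \<le> C0"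
          unfolding C0_def by (rule sbm_I_le[OF n ab'(1,2,4) eps0])
        then have "X n \<le> real n / real (K n) * C0"
          unfolding X_def times_divide_eq_left[symmetric] by (intro mult_left_mono) auto
        moreover have "640 * C0 / \<epsilon> * (1 / 2) \<le> 640 * C0 / \<epsilon> * ln (real (K n))"
          using C0 \<epsilon> lK' by (intro mult_left_mono) auto
        ultimately have "(320 / \<epsilon>) * C0 \<le> real n / real (K n) * C0"
          using XY'[OF Y(4)] by simp
        then have "320 / \<epsilon> \<le> real n / real (K n)"
          using C0 by (rule mult_right_le_imp_le)
        then show ?thesis using \<epsilon> by (simp add: field_simps)
      qed
      show "P n \<epsilon>"
        unfolding P_def
      proof
        fix \<sigma> assume \<sigma>: "\<sigma> \<in> Theta0 n (K n) (\<eta> n)"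
        then have ne: "Theta0 n (K n) (\<eta> n) \<noteq> {}" by blast
        show "measure_pmf.expectation (sbm_graph n (a n) (b n) \<sigma>) (\<lambda>A. sbm_r n (K n) (est n A) \<sigma>)
            \<le> exp (- ((1 - \<epsilon>) * X n))"
          unfolding X_def
          by (rule expectation_sbm_r_le[OF n K ab'(1-3) w \<sigma> _ _ \<epsilon> h X1[unfolded X_def]
                X2[unfolded X_def] X3[unfolded X_def] N])
            (use est[OF ne] \<sigma> in blast)+
      qed
    qed
  qed
  obtain \<delta> where \<delta>: "\<delta> \<longlonglongrightarrow> 0" "\<And>n. P n (\<delta> n)"
    using eventually_imp_vanishing_witness[of P] P1 ev by blast
  \<comment> \<open>The loss enters as \<open>1 - \<delta> n\<close>, so the correction to the
    exponent is its negative.\<close>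
  have "(\<lambda>n. - \<delta> n) \<longlonglongrightarrow> 0" using tendsto_minus[OF \<delta>(1)] by simp
  moreover have "measure_pmf.expectation (sbm_graph n (a n) (b n) \<sigma>) (\<lambda>A. sbm_r n (K n) (est n A) \<sigma>)
      \<le> exp (- (1 + - \<delta> n) * (real n * sbm_I n (a n) (b n) / real (K n)))"
    if "\<sigma> \<in> Theta0 n (K n) (\<eta> n)" for n \<sigma>
    using \<delta>(2)[of n] that unfolding P_def X_def[symmetric] by (simp add: algebra_simps)
  ultimately show ?thesis by (intro exI[of _ "\<lambda>n. - \<delta> n"]) blast
qed

end
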